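(* Let $W$ and $V$ be $d$-dimensional worlds, $B=(U_B,L_B)$ a barrier of $W$ with middle set $M_B$, and $C=(U_C,L_C)$ a barrier of $V$ with middle set $M_C$, and suppose $B$ and $C$ are partially isomorphic with these middle sets and translation vector $t \in \mathbb{Z}^d$. Let $p \in M_B$ and let $q \in M_C$ be the position with $l_W(p) = l_V(q) + t$. Then $p$ is a $\mathcal{P}$-position if and only if $q$ is a $\mathcal{P}$-position.
   Context: Tree nim: a position is a finite tree, possibly empty, whose vertices carry positive integer sizes; a leaf is a vertex of degree at most $1$; a move chooses a leaf and decreases its size by a positive integer, deleting the vertex if its size becomes $0$; normal play. $p \rightarrow q$ means $q$ is reachable from $p$ in one move. A position is $\mathcal{P}$ iff no move leads to a $\mathcal{P}$-position. World: fix a finite tree $T$ with $d$ leaves ordered $l_1,\dots,l_d$ and positive sizes for its non-leaf vertices. Interior positions: underlying tree $T$, these non-leaf sizes, arbitrary positive leaf sizes; the world $W$ consists of interior positions together with all positions seen by some interior position; non-interior positions of $W$ are exterior. The lattice map $l_W$ sends a position to the tuple of sizes of $l_1,\dots,l_d$ ($0$ for a deleted leaf), a bijection onto $\{(n_1,\dots,n_d)\in\mathbb{N}_0^d: \text{at most one } n_i=0\}$. A ray in $W$ is a family $(r_m)_{m\ge0}$ with $l_W(r_m) = (a_1,\dots,a_{k-1},m,a_{k+1},\dots,a_d)$, $k$ its variable coordinate, the positive $a_i$ ($i\neq k$) its fixed coordinates; each ray contains exactly one $\mathcal{P}$-position $r_m$, and $\mathcal{P}(R)=m$. Barrier: partition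 $W=U_B\sqcup L_B$ with $U_B$ containing all exterior positions and such that $p\in U_B$, $q \in W$, $p\rightarrow q$ imply $q\in U_B$. A ray meeting $L_B$ is shadowed if $\mathcal{P}(R)<n_0$, $n_0$ the least $m$ with $r_m\in L_B$; other rays are not shadowed; $S(B)$ is the set of shadowed rays. A middle set for $B$ is a subset $M_B\subseteq L_B$ such that for any $p\in M_B$ and any $q\in W$ with $p\rightarrow q$, $q\in U_B\cup M_B$. Given $t\in\mathbb{Z}^d$, rays $R$ of $W$ and $R'$ of $V$ correspond if they have the same variable coordinate $k$ and fixed coordinates satisfying $a_i=b_i+t_i$ for all $i\neq k$. A partial isomorphism of $B$ and $C$ (with middle sets $M_B$, $M_C$ and translation $t$) means: $l_W(M_B) = l_V(M_C)+t$, and for every ray $R$ of $W$ with $R\cap M_B\neq\emptyset$ and its corresponding ray $R'$ of $V$, $R\in S(B)\iff R'\in S(C)$. *)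

theory Defs
  imports Main
begin

section \<open>Finite trees\<close>

text \<open>Undirected simple graphs, an edge being the two-element set of its end points.
  The empty graph counts as a tree, as positions of tree nim may be empty.\<close>

record 'a graph =
  verts :: "'a set"
  edges :: "'a set set"

definition adj :: "('a, 'z) graph_scheme \<Rightarrow> ('a \<times> 'a) set" where
  "adj G = {(u, v). {u, v} \<in> edges G}"

definition degree :: "('a, 'z) graph_scheme \<Rightarrow> 'a \<Rightarrow> nat" where
  "degree G v = card {e \<in> edges G. v \<in> e}"

definition finite_graph :: "('a, 'z) graph_scheme \<Rightarrow> bool" where
  "finite_graph G \<longleftrightarrow> finite (verts G) \<and>
     (\<forall>e\<in>edges G. \<exists>u\<in>verts G. \<exists>v\<in>verts G. u \<noteq> v \<and> e = {u, v})"

definition is_connected :: "('a, 'z) graph_scheme \<Rightarrow> bool" where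
  "is_connected G \<longleftrightarrow> (\<forall>u\<in>verts G. \<forall>v\<in>verts G. (u, v) \<in> (adj G)\<^sup>*)"

definition is_cycle :: "('a, 'z) graph_scheme \<Rightarrow> 'a list \<Rightarrow> bool" where
  "is_cycle G xs \<longleftrightarrow> distinct xs \<and> 3 \<le> length xs \<and>
     (\<forall>i<length xs. (xs ! i, xs ! (Suc i mod length xs)) \<in> adj G)"

definition finite_tree :: "('a, 'z) graph_scheme \<Rightarrow> bool" where
  "finite_tree G \<longleftrightarrow> finite_graph G \<and> is_connected G \<and> (\<nexists>xs. is_cycle G xs)"

definition leaves :: "('a, 'z) graph_scheme \<Rightarrow> 'a set" where
  "leaves G = {v \<in> verts G. degree G v \<le> 1}"


section \<open>Tree nim\<close>

text \<open>Sizes are extended by 0 outside the vertex set, so that positions with the same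
  tree and the same vertex sizes are equal, and a deleted leaf has size 0.\<close>

record 'a position = "'a graph" +
  size_of :: "'a \<Rightarrow> nat"

definition is_position :: "'a position \<Rightarrow> bool" where
  "is_position p \<longleftrightarrow> finite_tree p \<and>
     (\<forall>v\<in>verts p. 0 < size_of p v) \<and> (\<forall>v. v \<notin> verts p \<longrightarrow> size_of p v = 0)"

definition delete_vertex :: "'a \<Rightarrow> 'a position \<Rightarrow> 'a position" where
  "delete_vertex v p =
     \<lparr>verts = verts p - {v}, edges = {e \<in> edges p. v \<notin> e}, size_of = (size_of p)(v := 0)\<rparr>"

definition decrease :: "'a \<Rightarrow> nat \<Rightarrow> 'a position \<Rightarrow> 'a position" where
  "decrease v n p =
     (if n = size_of p v then delete_vertex v p
      else p\<lparr>size_of := (size_of p)(v := size_of p v - n)\<rparr>)"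

definition move :: "'a position \<Rightarrow> 'a position \<Rightarrow> bool" where
  "move p q \<longleftrightarrow> is_position p \<and>
     (\<exists>v\<in>leaves p. \<exists>n. 0 < n \<and> n \<le> size_of p v \<and> q = decrease v n p)"

lemma size_of_decrease:
  "size_of (decrease v n p) = (size_of p)(v := size_of p v - n)"
  by (simp add: decrease_def delete_vertex_def)

lemma move_decreases_total:
  assumes "move p q"
  shows "sum (size_of q) (verts q) < sum (size_of p) (verts p)"
proof -
  from assms obtain v n where pos: "is_position p" and v: "v \<in> verts p"
    and n: "0 < n" "n \<le> size_of p v" and q: "q = decrease v n p"
    by (auto simp: move_def leaves_def)
  have fin: "finite (verts p)"
    using pos by (simp add: is_position_def finite_tree_def finite_graph_def)
  have sub: "verts q \<subseteq> verts p"
    by (auto simp: q decrease_def delete_vertex_def)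
  have "sum (size_of q) (verts q) \<le> sum (size_of q) (verts p)"
    using fin sub by (intro sum_mono2) auto
  also have "\<dots> < sum (size_of p) (verts p)"
  proof (rule sum_strict_mono_ex1)
    show "finite (verts p)" by (fact fin)
    show "\<forall>u\<in>verts p. size_of q u \<le> size_of p u"
      by (simp add: q size_of_decrease)
    show "\<exists>u\<in>verts p. size_of q u < size_of p u"
      using v n by (intro bexI[of _ v]) (auto simp: q size_of_decrease)
  qed
  finally show ?thesis .
qed

function is_P_position :: "'a position \<Rightarrow> bool" where
  "is_P_position p \<longleftrightarrow> (\<forall>q. move p q \<longrightarrow> \<not> is_P_position q)"
  by auto
termination
  by (relation "measure (\<lambda>p. sum (size_of p) (verts p))") (auto intro: move_decreases_total)

declare is_P_position.simps [simp del]

lemma is_connected_delete_leaf: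
  assumes G: "finite_graph p" and conn: "is_connected p" and v: "v \<in> leaves p"
  shows "is_connected (delete_vertex v p)"
proof -
  let ?q = "delete_vertex v p"
  have finE: "finite (edges p)"
    by (rule finite_subset[of _ "Pow (verts p)"])
      (use G in \<open>auto simp: finite_graph_def\<close>)
  have uniq: "e = f" if "e \<in> edges p" "f \<in> edges p" "v \<in> e" "v \<in> f" for e f
  proof -
    have "card {e \<in> edges p. v \<in> e} \<le> Suc 0"
      using v by (simp add: leaves_def degree_def)
    then show ?thesis
      using that finE by (subst (asm) card_le_Suc0_iff_eq) auto
  qed
  have noloop: "{a, a} \<notin> edges p" for a
    using G by (fastforce simp: finite_graph_def)
  have step: "(x \<noteq> v \<longrightarrow> (u, x) \<in> (adj ?q)\<^sup>*) \<and>
      (x = v \<longrightarrow> (\<exists>y. y \<noteq> v \<and> {y, v} \<in> edges p \<and> (u, y) \<in> (adj ?q)\<^sup>*))"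
    if "(u, x) \<in> (adj p)\<^sup>*" "u \<noteq> v" for u x
    using that
  proof (induction rule: rtrancl_induct)
    case base
    then show ?case by simp
  next
    case (step x y)
    then have E: "{x, y} \<in> edges p" by (simp add: adj_def)
    consider "x = v" | "x \<noteq> v" "y = v" | "x \<noteq> v" "y \<noteq> v" by blast
    then show ?case
    proof cases
      case 1
      then obtain z where z: "z \<noteq> v" "{z, v} \<in> edges p" "(u, z) \<in> (adj ?q)\<^sup>*"
        using step by blast
      have "{z, v} = {x, y}" using uniq[OF z(2) E] 1 by simp
      then have "y = z" using 1 z(1) by (auto simp: doubleton_eq_iff)
      then show ?thesis using z by simp
    next
      case 2
      then show ?thesis using step E by auto
    next
      case 3
      then have "(x, y) \<in> adj ?q" using E by (simp add: adj_def delete_vertex_def)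
      then show ?thesis using 3 step by auto
    qed
  qed
  show ?thesis
    using conn step by (auto simp: is_connected_def delete_vertex_def)
qed

lemma is_position_move:
  assumes "move p q"
  shows "is_position q"
proof -
  from assms obtain v n where pos: "is_position p" and v: "v \<in> leaves p"
    and n: "0 < n" "n \<le> size_of p v" and q: "q = decrease v n p"
    by (auto simp: move_def)
  show ?thesis
  proof (cases "n = size_of p v")
    case True
    then have q': "q = delete_vertex v p" by (simp add: q decrease_def)
    have "finite_graph q"
      using pos by (fastforce simp: q' delete_vertex_def is_position_def finite_tree_def finite_graph_def)
    moreover have "is_connected q"
      unfolding q' using pos v
      by (intro is_connected_delete_leaf) (auto simp: is_position_def finite_tree_def)
    moreover have "\<not> is_cycle q xs" for xs
    proof
      assume "is_cycle q xs"
      then have "is_cycle p xs"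
        by (auto simp: is_cycle_def adj_def q' delete_vertex_def)
      then show False using pos by (simp add: is_position_def finite_tree_def)
    qed
    ultimately show ?thesis
      using pos by (auto simp: is_position_def finite_tree_def q' delete_vertex_def)
  next
    case False
    then show ?thesis
      using pos n v
      by (auto simp: q decrease_def is_position_def finite_tree_def finite_graph_def
          is_connected_def is_cycle_def adj_def leaves_def)
  qed
qed


section \<open>Worlds\<close>

text \<open>The underlying tree, the sizes of its non-leaf vertices (values of
  \<open>inner_size\<close> elsewhere are irrelevant) and its leaves in order. Coordinates are
  numbered from 0.\<close>

record 'a world = "'a graph" +
  inner_size :: "'a \<Rightarrow> nat"
  leaf_list :: "'a list"

definition is_world :: "nat \<Rightarrow> 'a world \<Rightarrow> bool" where
  "is_world d W \<longleftrightarrow> finite_tree W \<and>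
     distinct (leaf_list W) \<and> set (leaf_list W) = leaves W \<and> length (leaf_list W) = d \<and>
     (\<forall>v\<in>verts W - leaves W. 0 < inner_size W v)"

definition interior :: "'a world \<Rightarrow> 'a position set" where
  "interior W = {p. is_position p \<and> verts p = verts W \<and> edges p = edges W \<and>
     (\<forall>v\<in>verts W - leaves W. size_of p v = inner_size W v)}"

definition positions :: "'a world \<Rightarrow> 'a position set" where
  "positions W = interior W \<union> {q. \<exists>p\<in>interior W. move p q}"

definition exterior :: "'a world \<Rightarrow> 'a position set" where
  "exterior W = positions W - interior W"

definition lattice_map :: "'a world \<Rightarrow> 'a position \<Rightarrow> nat list" where
  "lattice_map W p = map (size_of p) (leaf_list W)"

definition translate :: "int list \<Rightarrow> nat list \<Rightarrow> int list" where
  "translate t ns = map2 (\<lambda>n s. int n + s) ns t"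


section \<open>Rays\<close>

text \<open>\<open>is_ray_at W k a r\<close>: the ray \<open>r\<close> has variable coordinate \<open>k\<close> and fixed coordinates
  \<open>a ! i\<close> for \<open>i \<noteq> k\<close>; the entry \<open>a ! k\<close> is irrelevant.\<close>

definition is_ray_at :: "'a world \<Rightarrow> nat \<Rightarrow> nat list \<Rightarrow> (nat \<Rightarrow> 'a position) \<Rightarrow> bool" where
  "is_ray_at W k a r \<longleftrightarrow> length a = length (leaf_list W) \<and> k < length a \<and>
     (\<forall>i<length a. i \<noteq> k \<longrightarrow> 0 < a ! i) \<and>
     (\<forall>m. r m \<in> positions W \<and> lattice_map W (r m) = a[k := m])"

definition is_ray :: "'a world \<Rightarrow> (nat \<Rightarrow> 'a position) \<Rightarrow> bool" where
  "is_ray W r \<longleftrightarrow> (\<exists>k a. is_ray_at W k a r)"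

definition P_value :: "(nat \<Rightarrow> 'a position) \<Rightarrow> nat" where
  "P_value r = (THE m. is_P_position (r m))"

definition corresponding_rays ::
  "'a world \<Rightarrow> 'b world \<Rightarrow> int list \<Rightarrow> (nat \<Rightarrow> 'a position) \<Rightarrow> (nat \<Rightarrow> 'b position) \<Rightarrow> bool" where
  "corresponding_rays W V t r r' \<longleftrightarrow>
     (\<exists>k a b. is_ray_at W k a r \<and> is_ray_at V k b r' \<and>
        (\<forall>i<length a. i \<noteq> k \<longrightarrow> int (a ! i) = int (b ! i) + t ! i))"


section \<open>Barriers and partial isomorphism\<close>

definition is_barrier :: "'a world \<Rightarrow> 'a position set \<Rightarrow> 'a position set \<Rightarrow> bool" where
  "is_barrier W U L \<longleftrightarrow> U \<union> L = positions W \<and> U \<inter> L = {} \<and> exterior W \<subseteq> U \<and>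
     (\<forall>p\<in>U. \<forall>q\<in>positions W. move p q \<longrightarrow> q \<in> U)"

definition shadowed_rays :: "'a world \<Rightarrow> 'a position set \<Rightarrow> (nat \<Rightarrow> 'a position) set" where
  "shadowed_rays W L =
     {r. is_ray W r \<and> range r \<inter> L \<noteq> {} \<and> P_value r < (LEAST m. r m \<in> L)}"

definition is_middle_set ::
  "'a world \<Rightarrow> 'a position set \<Rightarrow> 'a position set \<Rightarrow> 'a position set \<Rightarrow> bool" where
  "is_middle_set W U L M \<longleftrightarrow> M \<subseteq> L \<and>
     (\<forall>p\<in>M. \<forall>q\<in>positions W. move p q \<longrightarrow> q \<in> U \<union> M)"

definition partially_isomorphic ::
  "'a world \<Rightarrow> 'a position set \<Rightarrow> 'a position set \<Rightarrow>
   'b world \<Rightarrow> 'b position set \<Rightarrow> 'b position set \<Rightarrow> int list \<Rightarrow> bool" where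
  "partially_isomorphic W L\<^sub>B M\<^sub>B V L\<^sub>C M\<^sub>C t \<longleftrightarrow>
     (\<lambda>p. map int (lattice_map W p)) ` M\<^sub>B = (\<lambda>q. translate t (lattice_map V q)) ` M\<^sub>C \<and>
     (\<forall>r r'. is_ray W r \<and> range r \<inter> M\<^sub>B \<noteq> {} \<and> corresponding_rays W V t r r' \<longrightarrow>
        (r \<in> shadowed_rays W L\<^sub>B \<longleftrightarrow> r' \<in> shadowed_rays V L\<^sub>C))"

end

(* Along an axis of the world every position has a move to every lower one, so a ray
   carries at most one P-position; it carries one because otherwise infinitely many of its
   positions would move to P-positions off the ray with only finitely many choices of leaf
   and amount, and two with the same choice are joined by a move.

   Let p and q be matched positions of the two middle sets. If p moves to a P-position
   inside the middle set, the matching position on the other side is P by induction and is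
   reached from q. If p moves to a P-position in the upper part, the ray through p is
   shadowed, hence so is the ray through q, and its P-position lies below q. *)
theory Submission
  imports Defs
begin

section \<open>Rays in the direction of one vertex\<close>

text \<open>An explicit ray through a given position, so that no family has to be chosen from
  coordinates. Size 0 needs its own case because positions have no vertices of size 0; in both cases
  the old size of \<open>v\<close> is forgotten.\<close>

definition axis_ray :: "'a \<Rightarrow> 'a position \<Rightarrow> nat \<Rightarrow> 'a position" where
  "axis_ray v p m =
     (if m = 0 then delete_vertex v p else p\<lparr>size_of := (size_of p)(v := m)\<rparr>)"

lemma size_of_axis_ray: "size_of (axis_ray v p m) = (size_of p)(v := m)"
  by (simp add: axis_ray_def delete_vertex_def)

lemma verts_axis_ray: "0 < m \<Longrightarrow> verts (axis_ray v p m) = verts p"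
  and edges_axis_ray: "0 < m \<Longrightarrow> edges (axis_ray v p m) = edges p"
  by (simp_all add: axis_ray_def)

lemma leaves_cong:
  assumes "verts G = verts H" "edges G = edges H"
  shows "leaves G = leaves H"
  using assms by (simp add: leaves_def degree_def)

lemma finite_tree_cong:
  assumes "verts G = verts H" "edges G = edges H"
  shows "finite_tree G \<longleftrightarrow> finite_tree H"
  using assms
  by (simp add: finite_tree_def finite_graph_def is_connected_def is_cycle_def adj_def)

lemma is_position_axis_ray:
  assumes "is_position p" "v \<in> verts p" "0 < m"
  shows "is_position (axis_ray v p m)"
  using assms finite_tree_cong[of "axis_ray v p m" p]
  by (auto simp: is_position_def size_of_axis_ray verts_axis_ray edges_axis_ray)

lemma axis_ray_self: "0 < size_of p v \<Longrightarrow> axis_ray v p (size_of p v) = p"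
  by (simp add: axis_ray_def)

lemma decrease_eq_axis_ray: "0 < n \<Longrightarrow> n \<le> size_of p v \<Longrightarrow>
    decrease v n p = axis_ray v p (size_of p v - n)"
  by (simp add: axis_ray_def decrease_def)

text \<open>Guarded by \<open>0 < m\<close> because at 0 the vertex and its edges are gone, and a
  later size update does not bring them back.\<close>

lemma axis_ray_axis_ray: "0 < m \<Longrightarrow> axis_ray v (axis_ray v p m) n = axis_ray v p n"
  by (simp add: axis_ray_def delete_vertex_def)

lemma move_axis_ray:
  assumes "is_position p" "v \<in> leaves p" "m < n"
  shows "move (axis_ray v p n) (axis_ray v p m)"
proof -
  let ?r = "axis_ray v p n"
  have n: "0 < n" using assms(3) by simp
  have "leaves ?r = leaves p"
    using n by (intro leaves_cong) (simp_all add: verts_axis_ray edges_axis_ray)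
  moreover have "is_position ?r"
    using assms n by (intro is_position_axis_ray) (auto simp: leaves_def)
  moreover have "axis_ray v p m = decrease v (n - m) ?r"
    using assms(3) n
    by (subst decrease_eq_axis_ray) (simp_all add: size_of_axis_ray axis_ray_axis_ray)
  ultimately show ?thesis
    using assms n unfolding move_def
    by (auto simp: size_of_axis_ray intro!: bexI[of _ v] exI[of _ "n - m"])
qed

text \<open>Puts the results of one fixed move, made at another vertex from different points of a
  ray, on a single new ray.\<close>

lemma decrease_axis_ray_commute:
  assumes "v \<noteq> w" "0 < m"
  shows "decrease w n (axis_ray v p m) = axis_ray v (decrease w n p) m"
  using assms by (auto simp: axis_ray_def decrease_def delete_vertex_def fun_upd_twist)

section \<open>Existence and uniqueness of the P-position on a ray\<close>

lemma P_position_move: "is_P_position p \<Longrightarrow> move p q \<Longrightarrow> \<not> is_P_position q"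
  by (subst (asm) is_P_position.simps) blast

lemma not_P_position_iff: "\<not> is_P_position p \<longleftrightarrow> (\<exists>q. move p q \<and> is_P_position q)"
  by (subst is_P_position.simps) blast

lemma axis_ray_P_unique:
  assumes "is_position p" "v \<in> leaves p"
    and "is_P_position (axis_ray v p m)" "is_P_position (axis_ray v p n)"
  shows "m = n"
  using move_axis_ray[OF assms(1,2), of m n] move_axis_ray[OF assms(1,2), of n m]
    P_position_move[OF assms(3)] P_position_move[OF assms(4)] assms(3,4)
  by (meson nat_neq_iff)

lemma finite_leaves: "is_position p \<Longrightarrow> finite (leaves p)"
  by (simp add: is_position_def finite_tree_def finite_graph_def leaves_def)

text \<open>Deleting another vertex only removes edges, so the degree of \<open>v\<close> cannot
  grow; an isolated vertex still counts as a leaf.\<close>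

lemma leaf_after_decrease:
  assumes "is_position p" "v \<in> leaves p" "v \<noteq> w"
  shows "v \<in> leaves (decrease w n p)"
proof -
  have "finite (edges p)"
    by (rule finite_subset[of _ "Pow (verts p)"])
      (use assms(1) in \<open>auto simp: is_position_def finite_tree_def finite_graph_def\<close>)
  then have "card {e \<in> edges p. w \<notin> e \<and> v \<in> e} \<le> card {e \<in> edges p. v \<in> e}"
    by (intro card_mono) auto
  then show ?thesis
    using assms by (auto simp: leaves_def degree_def decrease_def delete_vertex_def)
qed

lemma axis_ray_P_exists:
  assumes pos: "is_position p" and v: "v \<in> leaves p"
  shows "\<exists>m. is_P_position (axis_ray v p m)"
proof (rule ccontr)
  assume no_P: "\<nexists>m. is_P_position (axis_ray v p m)"
  \<comment> \<open>This set does not depend on the point of the ray, since sizes away from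
    \<open>v\<close> are constant along it.\<close>
  define choices where "choices = (SIGMA w : leaves p. {..size_of p w})"
  \<comment> \<open>The index is \<open>Suc i\<close> to stay off the end point of the ray: there
    \<open>v\<close> is deleted and the set of leaves may change.\<close>
  have "\<exists>c\<in>choices. fst c \<noteq> v \<and> 0 < snd c \<and>
      is_P_position (decrease (fst c) (snd c) (axis_ray v p (Suc i)))" for i
  proof -
    let ?r = "axis_ray v p (Suc i)"
    obtain x where x: "move ?r x" "is_P_position x"
      using no_P not_P_position_iff by blast
    then obtain w n where w: "w \<in> leaves ?r" and n: "0 < n" "n \<le> size_of ?r w"
      and x_eq: "x = decrease w n ?r"
      by (auto simp: move_def)
    have "leaves ?r = leaves p"
      by (intro leaves_cong) (simp_all add: verts_axis_ray edges_axis_ray)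
    \<comment> \<open>A move at \<open>v\<close> would stay on the ray, where no P-position is
      available.\<close>
    moreover have "w \<noteq> v"
      using no_P x(2) n by (auto simp: x_eq decrease_eq_axis_ray axis_ray_axis_ray)
    ultimately show ?thesis
      using w n x(2)
      by (intro bexI[of _ "(w, n)"]) (auto simp: choices_def size_of_axis_ray x_eq)
  qed
  then obtain c where c: "\<And>i. c i \<in> choices" "\<And>i. fst (c i) \<noteq> v" "\<And>i. 0 < snd (c i)"
    "\<And>i. is_P_position (decrease (fst (c i)) (snd (c i)) (axis_ray v p (Suc i)))"
    by metis
  have "finite choices"
    using finite_leaves[OF pos] by (simp add: choices_def)
  then have "finite (range c)"
    using c(1) by (meson finite_subset image_subsetI)
  then have "\<not> inj c"
    using finite_imageD infinite_UNIV_nat by blast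
  then obtain i j where ij: "i \<noteq> j" "c i = c j"
    by (auto simp: inj_def)
  obtain w n where wn: "c i = (w, n)" by fastforce
  have w: "w \<in> leaves p" "n \<le> size_of p w" "w \<noteq> v" "0 < n"
    using c(1-3)[of i] wn by (auto simp: choices_def)
  \<comment> \<open>The shared choice \<open>(w, n)\<close> sends both ray points to the axis of
    \<open>v\<close> through \<open>?p'\<close>, at the different heights \<open>Suc i\<close> and
    \<open>Suc j\<close>.\<close>
  let ?p' = "decrease w n p"
  have "move p ?p'" using w pos by (auto simp: move_def)
  then have pos': "is_position ?p'" by (rule is_position_move)
  have v': "v \<in> leaves ?p'" using pos v w(3) by (intro leaf_after_decrease) auto
  have "is_P_position (axis_ray v ?p' (Suc i))" "is_P_position (axis_ray v ?p' (Suc j))"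
    using c(4)[of i] c(4)[of j] wn ij w(3) by (simp_all add: decrease_axis_ray_commute)
  then show False
    using axis_ray_P_unique[OF pos' v'] ij(1) by blast
qed

lemma P_value_axis_ray_eq:
  assumes "is_position p" "v \<in> leaves p" "is_P_position (axis_ray v p m)"
  shows "P_value (axis_ray v p) = m"
  unfolding P_value_def
  using assms(3) axis_ray_P_unique[OF assms(1,2) _ assms(3)] by (rule the_equality)

lemma is_P_position_P_value:
  assumes "is_position p" "v \<in> leaves p"
  shows "is_P_position (axis_ray v p (P_value (axis_ray v p)))"
  using axis_ray_P_exists[OF assms] P_value_axis_ray_eq[OF assms] by blast

section \<open>Interior positions, their moves and their rays\<close>

lemma leaves_interior: "p \<in> interior W \<Longrightarrow> leaves p = leaves W"
  by (rule leaves_cong) (simp_all add: interior_def)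

lemma is_position_interior: "p \<in> interior W \<Longrightarrow> is_position p"
  by (simp add: interior_def)

lemma leaf_size_pos_interior: "p \<in> interior W \<Longrightarrow> v \<in> leaves W \<Longrightarrow> 0 < size_of p v"
  by (auto simp: interior_def is_position_def leaves_def)

lemma axis_ray_in_interior:
  assumes "p \<in> interior W" "v \<in> leaves W" "0 < m"
  shows "axis_ray v p m \<in> interior W"
proof -
  have "is_position (axis_ray v p m)"
    using assms by (intro is_position_axis_ray) (auto simp: interior_def leaves_def)
  then show ?thesis
    using assms by (auto simp: interior_def verts_axis_ray edges_axis_ray size_of_axis_ray)
qed

lemma move_interior_axis_ray:
  assumes "p \<in> interior W" "v \<in> leaves W" "m < size_of p v"
  shows "move p (axis_ray v p m)"
  using assms move_axis_ray[of p v m "size_of p v"]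
  by (simp add: leaves_interior is_position_interior axis_ray_self)

lemma axis_ray_in_positions:
  assumes "p \<in> interior W" "v \<in> leaves W"
  shows "axis_ray v p m \<in> positions W"
proof (cases "m = 0")
  case True
  then show ?thesis
    using assms move_interior_axis_ray leaf_size_pos_interior
    by (fastforce simp: positions_def)
next
  case False
  then show ?thesis
    using assms axis_ray_in_interior by (fastforce simp: positions_def)
qed

lemma interior_moveE:
  assumes "p \<in> interior W" "move p q"
  obtains v m where "v \<in> leaves W" "m < size_of p v" "q = axis_ray v p m"
proof -
  obtain v n where "v \<in> leaves p" "0 < n" "n \<le> size_of p v" "q = decrease v n p"
    using assms(2) by (auto simp: move_def)
  then show thesis
    using that[of v "size_of p v - n"] assms(1)
    by (simp add: leaves_interior decrease_eq_axis_ray)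
qed

text \<open>The world fixes the tree and all non-leaf sizes, and sizes vanish outside the tree, so
  only the size at \<open>v\<close> is left free.\<close>

lemma interior_eq_axis_ray:
  assumes "p \<in> interior W" "q \<in> interior W" "v \<in> leaves W"
    and same: "\<And>u. u \<in> leaves W \<Longrightarrow> u \<noteq> v \<Longrightarrow> size_of q u = size_of p u"
  shows "q = axis_ray v p (size_of q v)"
proof -
  have "size_of q u = ((size_of p)(v := size_of q v)) u" for u
    using assms
    by (cases "u \<in> verts W"; cases "u \<in> leaves W"; cases "u = v")
      (auto simp: interior_def is_position_def)
  then have "size_of q = (size_of p)(v := size_of q v)" by (rule ext)
  then have "size_of q = size_of (axis_ray v p (size_of q v))" by (simp only: size_of_axis_ray)
  moreover have "0 < size_of q v" using assms by (intro leaf_size_pos_interior)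
  moreover have "verts q = verts p" "edges q = edges p" using assms by (simp_all add: interior_def)
  ultimately show ?thesis
    by (intro position.equality) (simp_all add: verts_axis_ray edges_axis_ray)
qed

text \<open>Links the explicit rays to the coordinate description. Distinctness of the leaf list
  ensures that changing the size of one leaf changes one coordinate only.\<close>

lemma is_ray_at_axis_ray:
  assumes W: "is_world d W" and p: "p \<in> interior W" and k: "k < d"
  shows "is_ray_at W k (lattice_map W p) (axis_ray (leaf_list W ! k) p)"
proof -
  let ?v = "leaf_list W ! k"
  have len: "length (leaf_list W) = d" and leaf: "\<And>i. i < d \<Longrightarrow> leaf_list W ! i \<in> leaves W"
    and dist: "distinct (leaf_list W)"
    using W nth_mem[of _ "leaf_list W"] by (auto simp: is_world_def)
  have "lattice_map W (axis_ray ?v p m) = (lattice_map W p)[k := m]" for m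
    using k len dist
    by (intro nth_equalityI)
      (auto simp: lattice_map_def size_of_axis_ray nth_list_update nth_eq_iff_index_eq)
  moreover have "0 < lattice_map W p ! i" if "i < d" for i
    using that len leaf leaf_size_pos_interior[OF p] by (simp add: lattice_map_def)
  ultimately show ?thesis
    using k len leaf axis_ray_in_positions[OF p] by (simp add: is_ray_at_def lattice_map_def)
qed

section \<open>Barriers and shadowed rays\<close>

lemma barrier_lower_interior: "is_barrier W U L \<Longrightarrow> p \<in> L \<Longrightarrow> p \<in> interior W"
  by (auto simp: is_barrier_def exterior_def)

text \<open>The upper part is closed under moves, so it contains the whole ray from height
  \<open>m\<close> downwards, and the first point of \<open>L\<close> lies above the
  P-position.\<close>

lemma shadowed_if_P_in_upper:
  assumes B: "is_barrier W U L" and p: "p \<in> L" and v: "v \<in> leaves W"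
    and ray: "is_ray W (axis_ray v p)"
    and m: "axis_ray v p m \<in> U" "is_P_position (axis_ray v p m)"
  shows "axis_ray v p \<in> shadowed_rays W L"
proof -
  have int: "p \<in> interior W" using barrier_lower_interior[OF B p] .
  note pos = is_position_interior[OF int]
  have v': "v \<in> leaves p" using v leaves_interior[OF int] by simp
  have p_eq: "axis_ray v p (size_of p v) = p"
    using leaf_size_pos_interior[OF int v] by (rule axis_ray_self)
  have above: "m < j" if "axis_ray v p j \<in> L" for j
  proof (rule ccontr)
    assume "\<not> m < j"
    then have "j = m \<or> move (axis_ray v p m) (axis_ray v p j)"
      using move_axis_ray[OF pos v', of j m] by (meson nat_neq_iff)
    then have "axis_ray v p j \<in> U"
      using B m(1) axis_ray_in_positions[OF int v] unfolding is_barrier_def by blast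
    then show False using B that by (auto simp: is_barrier_def)
  qed
  \<comment> \<open>The point \<open>p\<close> itself shows that the minimum is attained.\<close>
  have "axis_ray v p (LEAST j. axis_ray v p j \<in> L) \<in> L"
    using p p_eq LeastI[of "\<lambda>j. axis_ray v p j \<in> L" "size_of p v"] by simp
  then have "P_value (axis_ray v p) < (LEAST j. axis_ray v p j \<in> L)"
    using above P_value_axis_ray_eq[OF pos v' m(2)] by simp
  moreover have "range (axis_ray v p) \<inter> L \<noteq> {}"
    using p p_eq by (metis disjoint_iff rangeI)
  ultimately show ?thesis using ray by (simp add: shadowed_rays_def)
qed

text \<open>The P-position of the ray lies below its first point in \<open>L\<close>, hence below
  \<open>p\<close>, and \<open>p\<close> moves to it.\<close>

lemma not_P_if_shadowed:
  assumes B: "is_barrier W U L" and p: "p \<in> L" and v: "v \<in> leaves W"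
    and shadowed: "axis_ray v p \<in> shadowed_rays W L"
  shows "\<not> is_P_position p"
proof -
  have int: "p \<in> interior W" using barrier_lower_interior[OF B p] .
  have "(LEAST j. axis_ray v p j \<in> L) \<le> size_of p v"
    using p leaf_size_pos_interior[OF int v] by (intro Least_le) (simp add: axis_ray_self)
  then have "P_value (axis_ray v p) < size_of p v"
    using shadowed by (simp add: shadowed_rays_def)
  then have "move p (axis_ray v p (P_value (axis_ray v p)))"
    using int v by (intro move_interior_axis_ray)
  moreover have "is_P_position (axis_ray v p (P_value (axis_ray v p)))"
    using int v by (intro is_P_position_P_value) (simp_all add: is_position_interior leaves_interior)
  ultimately show ?thesis using not_P_position_iff by blast
qed

section \<open>Matched positions and the transfer between worlds\<close>

text \<open>The shift is a function of the index rather than a list, so that exchanging the two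
  worlds just negates it pointwise.\<close>

definition matched :: "nat \<Rightarrow> (nat \<Rightarrow> int) \<Rightarrow> 'a world \<Rightarrow> 'b world \<Rightarrow> 'a position \<Rightarrow> 'b position \<Rightarrow> bool" where
  "matched d s W V p q \<longleftrightarrow> (\<forall>i<d. int (size_of p (leaf_list W ! i)) =
     int (size_of q (leaf_list V ! i)) + s i)"

lemma matched_sym: "matched d s W V p q \<longleftrightarrow> matched d (\<lambda>i. - s i) V W q p"
  by (auto simp: matched_def)

lemma matched_iff_translate:
  assumes "is_world d W" "is_world d V" "length t = d"
  shows "map int (lattice_map W p) = translate t (lattice_map V q) \<longleftrightarrow> matched d ((!) t) W V p q"
  using assms by (auto simp: matched_def list_eq_iff_nth_eq translate_def lattice_map_def is_world_def)

text \<open>One direction only, with hypotheses that survive exchanging the worlds, so that it can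
  be applied twice. \<open>IH\<close> may assume a move on both sides, which lets either side carry
  the induction measure.\<close>

lemma not_P_transfer:
  assumes W: "is_world d W" and V: "is_world d V"
    and B: "is_barrier W U\<^sub>B L\<^sub>B" and MB: "is_middle_set W U\<^sub>B L\<^sub>B M\<^sub>B"
    and C: "is_barrier V U\<^sub>C L\<^sub>C" and MC: "is_middle_set V U\<^sub>C L\<^sub>C M\<^sub>C"
    and partner: "\<And>p'. p' \<in> M\<^sub>B \<Longrightarrow> \<exists>q'\<in>M\<^sub>C. matched d s W V p' q'"
    and shadow: "\<And>k. k < d \<Longrightarrow> axis_ray (leaf_list W ! k) p \<in> shadowed_rays W L\<^sub>B \<Longrightarrow>
        axis_ray (leaf_list V ! k) q \<in> shadowed_rays V L\<^sub>C"
    and p: "p \<in> M\<^sub>B" and q: "q \<in> M\<^sub>C" and pq: "matched d s W V p q"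
    and IH: "\<And>p' q'. move p p' \<Longrightarrow> move q q' \<Longrightarrow> p' \<in> M\<^sub>B \<Longrightarrow> q' \<in> M\<^sub>C \<Longrightarrow> matched d s W V p' q' \<Longrightarrow>
        is_P_position p' \<Longrightarrow> is_P_position q'"
    and not_P: "\<not> is_P_position p"
  shows "\<not> is_P_position q"
proof -
  have L: "p \<in> L\<^sub>B" "q \<in> L\<^sub>C" using MB MC p q by (auto simp: is_middle_set_def)
  have int: "p \<in> interior W" using barrier_lower_interior[OF B L(1)] .
  have int': "x \<in> interior V" if "x \<in> M\<^sub>C" for x
    using MC that barrier_lower_interior[OF C] by (auto simp: is_middle_set_def)
  have world: "set (leaf_list W) = leaves W" "length (leaf_list W) = d" "distinct (leaf_list W)"
    "set (leaf_list V) = leaves V" "length (leaf_list V) = d"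
    using W V by (auto simp: is_world_def)
  obtain p' where p': "move p p'" "is_P_position p'"
    using not_P not_P_position_iff by blast
  obtain v m where v: "v \<in> leaves W" and m: "m < size_of p v" and p'_eq: "p' = axis_ray v p m"
    using interior_moveE[OF int p'(1)] .
  obtain k where k: "k < d" "v = leaf_list W ! k"
    using v unfolding world(1)[symmetric] in_set_conv_nth world(2) by blast
  let ?v' = "leaf_list V ! k"
  have v': "?v' \<in> leaves V" using k world nth_mem by metis
  have "p' \<in> U\<^sub>B \<union> M\<^sub>B"
    using MB p p'(1) axis_ray_in_positions[OF int v] unfolding is_middle_set_def p'_eq by blast
  then show ?thesis
  proof
    assume "p' \<in> U\<^sub>B"
    moreover have "is_ray W (axis_ray v p)"
      using is_ray_at_axis_ray[OF W int k(1)] k(2) by (auto simp: is_ray_def)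
    ultimately have "axis_ray v p \<in> shadowed_rays W L\<^sub>B"
      using shadowed_if_P_in_upper[OF B L(1) v] p'(2) p'_eq by blast
    then show ?thesis
      using not_P_if_shadowed[OF C L(2) v'] shadow k by blast
  next
    assume "p' \<in> M\<^sub>B"
    then obtain q' where q': "q' \<in> M\<^sub>C" "matched d s W V p' q'"
      using partner by blast
    \<comment> \<open>Away from \<open>v\<close> the positions \<open>p\<close> and
      \<open>p'\<close> agree, and both pairs are matched by the same shift.\<close>
    have "size_of q' u = size_of q u" if u: "u \<in> leaves V" "u \<noteq> ?v'" for u
    proof -
      obtain i where i: "i < d" "u = leaf_list V ! i"
        using u(1) unfolding world(4)[symmetric] in_set_conv_nth world(5) by blast
      then have "leaf_list W ! i \<noteq> v"
        using u(2) i(2) k world by (auto simp: nth_eq_iff_index_eq)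
      moreover have "int (size_of p' (leaf_list W ! i)) = int (size_of q' u) + s i"
        "int (size_of p (leaf_list W ! i)) = int (size_of q u) + s i"
        using q'(2) pq i by (auto simp: matched_def)
      ultimately show ?thesis by (simp add: p'_eq size_of_axis_ray)
    qed
    then have "q' = axis_ray ?v' q (size_of q' ?v')"
      using int' q q'(1) v' by (intro interior_eq_axis_ray[of q V]) auto
    \<comment> \<open>The common shift at coordinate \<open>k\<close> carries the inequality
      \<open>m < size_of p v\<close> over to the other world.\<close>
    moreover have "size_of q' ?v' < size_of q ?v'"
    proof -
      have "int m = int (size_of q' ?v') + s k" "int (size_of p v) = int (size_of q ?v') + s k"
        using q'(2) pq k by (auto simp: matched_def p'_eq size_of_axis_ray)
      then show ?thesis using m by linarith
    qed
    ultimately have "move q q'"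
      using move_interior_axis_ray[OF int'[OF q] v'] by metis
    moreover from this have "is_P_position q'"
      using IH[OF p'(1) _ \<open>p' \<in> M\<^sub>B\<close> q' p'(2)] by blast
    ultimately show ?thesis using not_P_position_iff by blast
  qed
qed

theorem mainTheorem6:
  fixes d :: nat and t :: "int list"
    and W :: "'a world" and V :: "'b world"
    and U\<^sub>B L\<^sub>B M\<^sub>B :: "'a position set" and U\<^sub>C L\<^sub>C M\<^sub>C :: "'b position set"
    and p :: "'a position" and q :: "'b position"
  assumes "is_world d W" and "is_world d V"
    and "is_barrier W U\<^sub>B L\<^sub>B" and "is_middle_set W U\<^sub>B L\<^sub>B M\<^sub>B"
    and "is_barrier V U\<^sub>C L\<^sub>C" and "is_middle_set V U\<^sub>C L\<^sub>C M\<^sub>C"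
    and "length t = d"
    and "partially_isomorphic W L\<^sub>B M\<^sub>B V L\<^sub>C M\<^sub>C t"
    and "p \<in> M\<^sub>B" and "q \<in> M\<^sub>C"
    and "map int (lattice_map W p) = translate t (lattice_map V q)"
  shows "is_P_position p \<longleftrightarrow> is_P_position q"
proof -
  note W = assms(1) and V = assms(2) and B = assms(3) and MB = assms(4)
    and C = assms(5) and MC = assms(6) and len = assms(7) and iso = assms(8)
  let ?s = "(!) t"
  note match_iff = matched_iff_translate[OF W V len]
  have image: "(\<lambda>p. map int (lattice_map W p)) ` M\<^sub>B = (\<lambda>q. translate t (lattice_map V q)) ` M\<^sub>C"
    using iso by (simp add: partially_isomorphic_def)
  have partner: "\<exists>y\<in>M\<^sub>C. matched d ?s W V x y" if x: "x \<in> M\<^sub>B" for x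
  proof -
    have "map int (lattice_map W x) \<in> (\<lambda>q. translate t (lattice_map V q)) ` M\<^sub>C"
      unfolding image[symmetric] using x by (rule imageI)
    then show ?thesis using match_iff by blast
  qed
  have partner': "\<exists>x\<in>M\<^sub>B. matched d (\<lambda>i. - ?s i) V W y x" if y: "y \<in> M\<^sub>C" for y
  proof -
    have "translate t (lattice_map V y) \<in> (\<lambda>p. map int (lattice_map W p)) ` M\<^sub>B"
      unfolding image using y by (rule imageI)
    then obtain x where "x \<in> M\<^sub>B" "map int (lattice_map W x) = translate t (lattice_map V y)"
      by auto
    then show ?thesis using match_iff matched_sym[of d ?s W V] by blast
  qed
  have shadow: "axis_ray (leaf_list W ! k) x \<in> shadowed_rays W L\<^sub>B \<longleftrightarrow>
      axis_ray (leaf_list V ! k) y \<in> shadowed_rays V L\<^sub>C"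
    if x: "x \<in> M\<^sub>B" and y: "y \<in> M\<^sub>C" and xy: "matched d ?s W V x y" and k: "k < d" for x y k
  proof -
    have int: "x \<in> interior W" "y \<in> interior V"
      using x y MB MC barrier_lower_interior[OF B] barrier_lower_interior[OF C]
      by (auto simp: is_middle_set_def)
    let ?r = "axis_ray (leaf_list W ! k) x" and ?r' = "axis_ray (leaf_list V ! k) y"
    note rays = is_ray_at_axis_ray[OF W int(1) k] is_ray_at_axis_ray[OF V int(2) k]
    have world: "length (leaf_list W) = d" "length (leaf_list V) = d" "leaf_list W ! k \<in> leaves W"
      using W V k nth_mem[of k "leaf_list W"] by (auto simp: is_world_def)
    have "\<forall>i<length (lattice_map W x). i \<noteq> k \<longrightarrow>
        int (lattice_map W x ! i) = int (lattice_map V y ! i) + t ! i"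
      using xy world(1,2) by (simp add: matched_def lattice_map_def)
    then have "corresponding_rays W V t ?r ?r'"
      using rays unfolding corresponding_rays_def by blast
    \<comment> \<open>The ray passes through \<open>x\<close>, so it meets the middle set and the
      shadowing condition of the partial isomorphism applies to it.\<close>
    moreover have "?r (size_of x (leaf_list W ! k)) = x"
      using leaf_size_pos_interior[OF int(1) world(3)] by (rule axis_ray_self)
    then have "range ?r \<inter> M\<^sub>B \<noteq> {}"
      using x rangeI[of ?r "size_of x (leaf_list W ! k)"] by auto
    ultimately show ?thesis
      using iso rays(1) unfolding partially_isomorphic_def is_ray_def by blast
  qed
  have "is_P_position p \<longleftrightarrow> is_P_position q"
    if "p \<in> M\<^sub>B" "q \<in> M\<^sub>C" "matched d ?s W V p q" for p q
    using that
  \<comment> \<open>Only the side of \<open>p\<close> is measured: in both directions of the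
    equivalence the hypothesis is used together with a move from \<open>p\<close>.\<close>
  proof (induction "sum (size_of p) (verts p)" arbitrary: p q rule: less_induct)
    case less
    have IH: "is_P_position p' \<longleftrightarrow> is_P_position q'"
      if "move p p'" "p' \<in> M\<^sub>B" "q' \<in> M\<^sub>C" "matched d ?s W V p' q'" for p' q'
      using less.hyps[OF move_decreases_total] that by blast
    have "\<not> is_P_position q" if "\<not> is_P_position p"
      by (rule not_P_transfer[OF W V B MB C MC partner _ less.prems _ that])
        (simp_all add: shadow[OF less.prems] IH)
    \<comment> \<open>The same transfer with the worlds exchanged and the shift negated.\<close>
    moreover have "\<not> is_P_position p" if not_P: "\<not> is_P_position q"
    proof (rule not_P_transfer[OF V W C MC B MB partner' _ less.prems(2,1) _ _ not_P])
      show "matched d (\<lambda>i. - ?s i) V W q p"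
        using less.prems(3) matched_sym[of d ?s W V] by blast
      show "is_P_position p'"
        if "move p p'" "q' \<in> M\<^sub>C" "p' \<in> M\<^sub>B"
          and "matched d (\<lambda>i. - ?s i) V W q' p'" "is_P_position q'" for q' p'
        using IH that matched_sym[of d ?s W V] by blast
    qed (simp_all add: shadow[OF less.prems])
    ultimately show ?case by blast
  qed
  then show ?thesis using assms(9-11) match_iff by blast
qed

end
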